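(* Let $g:\mathbb{N}\to\mathbb{N}$ be a function of subpolynomial growth, and let $\{\nu_n=\lambda^{(n)}/\mu^{(n)}\}$ be a sequence of connected skew shapes with $|\nu_n|=n$ which has subpolynomial depth shape associated with $g$. Then $$\log e(\nu_n)=n\log n-\Theta\bigl(n\log g(n)\bigr)\qquad\text{as } n\to\infty.$$
   Context: $e(\lambda/\mu)$ is the number of standard Young tableaux of skew shape $\lambda/\mu$; $\log$ is the natural logarithm. A function $g:\mathbb{N}\to\mathbb{N}$ has subpolynomial growth if $1\le g(n)\le n$, $g(n)\to\infty$ and $\log g(n)=o(\log n)$ as $n\to\infty$. For a skew shape $\lambda/\mu$ define $\mathrm{width}(\lambda/\mu)=\min\{\lambda_1,\lambda'_1\}$ and $\mathrm{depth}(\lambda/\mu)=\max_{u\in\lambda/\mu}h(u)$, where $\lambda'$ is the conjugate partition and $h(u)=\lambda_i-i+\lambda'_j-j+1$ is the hook-length in $\lambda$ of the cell $u=(i,j)$. The sequence $\{\nu_n\}$ has subpolynomial depth shape associated with $g$ if $$\mathrm{width}(\nu_n)=\Theta\!\left(\frac{n}{g(n)}\right)\quad\text{and}\quad\mathrm{depth}(\nu_n)=\Theta\bigl(g(n)\bigr).$$ *)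

theory Defs
  imports Complex_Main "HOL-Library.Landau_Symbols"
begin

text \<open>
  A partition is its sequence of parts, padded with zeros. Rows, columns and parts are indexed
  from 0, so the part \<open>\<lambda>\<^sub>1\<close> of the usual notation is \<open>l 0\<close>, and the usual cell \<open>(1, 1)\<close> is
  \<open>(0, 0)\<close>.
\<close>

definition is_partition :: "(nat \<Rightarrow> nat) \<Rightarrow> bool" where
  "is_partition l \<longleftrightarrow> antimono l \<and> finite {i. l i \<noteq> 0}"

definition conj_part :: "(nat \<Rightarrow> nat) \<Rightarrow> nat \<Rightarrow> nat" where
  "conj_part l j = card {i. j < l i}"

definition is_skew_shape :: "(nat \<Rightarrow> nat) \<Rightarrow> (nat \<Rightarrow> nat) \<Rightarrow> bool" where
  "is_skew_shape l m \<longleftrightarrow> is_partition l \<and> is_partition m \<and> (\<forall>i. m i \<le> l i)"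

definition cells :: "(nat \<Rightarrow> nat) \<Rightarrow> (nat \<Rightarrow> nat) \<Rightarrow> (nat \<times> nat) set" where
  "cells l m = {(i, j). m i \<le> j \<and> j < l i}"

definition skew_size :: "(nat \<Rightarrow> nat) \<Rightarrow> (nat \<Rightarrow> nat) \<Rightarrow> nat" where
  "skew_size l m = card (cells l m)"

definition adjacent :: "nat \<times> nat \<Rightarrow> nat \<times> nat \<Rightarrow> bool" where
  "adjacent u v \<longleftrightarrow>
     (fst u = fst v \<and> (snd v = Suc (snd u) \<or> snd u = Suc (snd v))) \<or>
     (snd u = snd v \<and> (fst v = Suc (fst u) \<or> fst u = Suc (fst v)))"

definition is_connected_skew :: "(nat \<Rightarrow> nat) \<Rightarrow> (nat \<Rightarrow> nat) \<Rightarrow> bool" where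
  "is_connected_skew l m \<longleftrightarrow>
     (\<forall>u\<in>cells l m. \<forall>v\<in>cells l m.
        (u, v) \<in> {(x, y). x \<in> cells l m \<and> y \<in> cells l m \<and> adjacent x y}\<^sup>*)"

text \<open>
  Tableaux are taken to be \<open>undefined\<close> off the diagram, so that distinct functions in this set are
  distinct tableaux.
\<close>

definition standard_tableaux :: "(nat \<Rightarrow> nat) \<Rightarrow> (nat \<Rightarrow> nat) \<Rightarrow> (nat \<times> nat \<Rightarrow> nat) set" where
  "standard_tableaux l m =
     {T. (\<forall>u. u \<notin> cells l m \<longrightarrow> T u = undefined) \<and>
         bij_betw T (cells l m) {1..skew_size l m} \<and>
         (\<forall>i j j'. (i, j) \<in> cells l m \<and> (i, j') \<in> cells l m \<and> j < j' \<longrightarrow> T (i, j) < T (i, j')) \<and>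
         (\<forall>i i' j. (i, j) \<in> cells l m \<and> (i', j) \<in> cells l m \<and> i < i' \<longrightarrow> T (i, j) < T (i', j))}"

definition num_syt :: "(nat \<Rightarrow> nat) \<Rightarrow> (nat \<Rightarrow> nat) \<Rightarrow> nat" where
  "num_syt l m = card (standard_tableaux l m)"

text \<open>
  With 1-based \<open>(i, j)\<close> the hook length is \<open>\<lambda>\<^sub>i - i + \<lambda>'\<^sub>j - j + 1\<close>; below, the terms are regrouped
  into arm and leg so that no subtraction truncates on a cell of \<open>l\<close>.
\<close>

definition hook_length :: "(nat \<Rightarrow> nat) \<Rightarrow> nat \<times> nat \<Rightarrow> nat" where
  "hook_length l = (\<lambda>(i, j). (l i - Suc j) + (conj_part l j - Suc i) + 1)"

definition skew_width :: "(nat \<Rightarrow> nat) \<Rightarrow> (nat \<Rightarrow> nat) \<Rightarrow> nat" where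
  "skew_width l m = min (l 0) (conj_part l 0)"

definition skew_depth :: "(nat \<Rightarrow> nat) \<Rightarrow> (nat \<Rightarrow> nat) \<Rightarrow> nat" where
  "skew_depth l m = Max (hook_length l ` cells l m)"

text \<open>
  Sequences are indexed by the positive integers; the value at 0 is irrelevant (the condition
  \<open>1 \<le> g n \<le> n\<close> has no solution there).
\<close>

definition subpolynomial_growth :: "(nat \<Rightarrow> nat) \<Rightarrow> bool" where
  "subpolynomial_growth g \<longleftrightarrow>
     (\<forall>n\<ge>1. 1 \<le> g n \<and> g n \<le> n) \<and>
     filterlim g at_top at_top \<and>
     (\<lambda>n. ln (real (g n))) \<in> o(\<lambda>n. ln (real n))"

definition subpolynomial_depth_shape ::
    "(nat \<Rightarrow> nat \<Rightarrow> nat) \<Rightarrow> (nat \<Rightarrow> nat \<Rightarrow> nat) \<Rightarrow> (nat \<Rightarrow> nat) \<Rightarrow> bool" where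
  "subpolynomial_depth_shape lam mu g \<longleftrightarrow>
     (\<lambda>n. real (skew_width (lam n) (mu n))) \<in> \<Theta>(\<lambda>n. real n / real (g n)) \<and>
     (\<lambda>n. real (skew_depth (lam n) (mu n))) \<in> \<Theta>(\<lambda>n. real (g n))"

end

(*
  Only crude bounds on the number e of tableaux are needed.

  Upper bound: every row (column) of a tableau is increasing, so the tableau is determined by the
  map sending each entry to its row (column).  Hence e \<le> width^n, which is (O(n / g))^n.

  Lower bound: for a finite poset, n! is at most the number of linear extensions times the product
  of the sizes of the principal filters; this follows by induction on removing a minimal element,
  because the filters of the minimal elements cover the poset.  The principal filter of a cell u
  lies in a rectangle with sides at most the hook length of u, so e is at least n! / depth^(2n).
*)
theory Submission
  imports Defs "HOL-Library.FuncSet" "HOL-Library.Product_Order"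
begin

section \<open>Linear extensions of finite posets\<close>

text \<open>The offset \<open>a\<close> lets labels run from \<open>a + 1\<close>: deleting a
  minimal element labelled \<open>Suc a\<close> leaves an extension with offset
  \<open>Suc a\<close>, so the induction needs no relabelling. The value \<open>undefined\<close>
  off \<open>P\<close> makes distinct functions distinct extensions.\<close>

definition linear_extensions :: "nat \<Rightarrow> 'a::order set \<Rightarrow> ('a \<Rightarrow> nat) set" where
  "linear_extensions a P =
     {T. (\<forall>x. x \<notin> P \<longrightarrow> T x = undefined) \<and> bij_betw T P {a<..a + card P} \<and>
         (\<forall>x\<in>P. \<forall>y\<in>P. x < y \<longrightarrow> T x < T y)}"

lemma finite_bij_extensional:
  assumes "finite P" and "finite V"
    and "\<And>T. T \<in> A \<Longrightarrow> (\<forall>x. x \<notin> P \<longrightarrow> T x = undefined) \<and> bij_betw T P V"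
  shows "finite A"
proof (rule finite_subset)
  show "A \<subseteq> P \<rightarrow>\<^sub>E V"
    using assms(3) by (fastforce simp: PiE_def extensional_def bij_betw_def)
  show "finite (P \<rightarrow>\<^sub>E V)"
    using assms by (simp add: finite_PiE)
qed

lemma finite_linear_extensions: "finite P \<Longrightarrow> finite (linear_extensions a P)"
  by (rule finite_bij_extensional[of P "{a<..a + card P}"])
    (auto simp: linear_extensions_def)

text \<open>The label \<open>Suc a\<close> is smaller than every label of \<open>T\<close>, and
  nothing in \<open>P\<close> lies below \<open>x\<close>, so the extended labelling still respects
  the order.\<close>

lemma linear_extension_add_minimal:
  assumes "finite P" and x: "x \<in> P" "\<And>y. y \<in> P \<Longrightarrow> \<not> y < x"
    and T: "T \<in> linear_extensions (Suc a) (P - {x})"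
  shows "T(x := Suc a) \<in> linear_extensions a P"
proof -
  have c: "Suc a + card (P - {x}) = a + card P"
    using assms(1) x(1) by (metis add_Suc_shift card_Suc_Diff1)
  have T': "T y = undefined" if "y \<notin> P - {x}" for y
    using T that by (auto simp: linear_extensions_def)
  have bij: "bij_betw T (P - {x}) {Suc a<..a + card P}"
    using T unfolding linear_extensions_def c by simp
  have mono: "T y < T z" if "y \<in> P - {x}" "z \<in> P - {x}" "y < z" for y z
    using T that by (auto simp: linear_extensions_def)
  have gt: "Suc a < T y" if "y \<in> P" "y \<noteq> x" for y
    using bij that by (auto simp: bij_betw_def)
  have pos: "card P > 0"
    using assms(1) x(1) by (metis card_gt_0_iff empty_iff)
  have "bij_betw (T(x := Suc a)) (P - {x}) {Suc a<..a + card P}"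
    using bij by (subst bij_betw_cong[of _ _ T]) auto
  from notIn_Un_bij_betw[OF _ _ this, of x]
  have "bij_betw (T(x := Suc a)) (insert x (P - {x})) (insert (Suc a) {Suc a<..a + card P})"
    by simp
  moreover have "insert x (P - {x}) = P" "insert (Suc a) {Suc a<..a + card P} = {a<..a + card P}"
    using x(1) pos by auto
  ultimately have "bij_betw (T(x := Suc a)) P {a<..a + card P}"
    by simp
  then show ?thesis
    using T' mono gt x by (auto simp: linear_extensions_def)
qed

text \<open>Both \<open>x\<close> and \<open>T\<close> can be recovered from
  \<open>T(x := Suc a)\<close>: \<open>x\<close> is the only element labelled \<open>Suc a\<close>,
  and \<open>T\<close> was \<open>undefined\<close> there. Extensions with different first elements
  are therefore counted separately.\<close>

lemma sum_card_linear_extensions_le: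
  fixes P :: "'a::order set"
  assumes "finite P"
  defines "M \<equiv> {x \<in> P. \<forall>y\<in>P. \<not> y < x}"
  shows "(\<Sum>x\<in>M. card (linear_extensions (Suc a) (P - {x}))) \<le> card (linear_extensions a P)"
proof -
  let ?S = "SIGMA x:M. linear_extensions (Suc a) (P - {x})"
  let ?f = "\<lambda>(x, T). T(x := Suc a)"
  have im: "?f ` ?S \<subseteq> linear_extensions a P"
    using assms(1) by (auto simp: M_def intro!: linear_extension_add_minimal)
  have inj: "inj_on ?f ?S"
  proof (clarsimp simp: inj_on_def)
    fix x y T U
    assume x: "x \<in> M" "T \<in> linear_extensions (Suc a) (P - {x})"
      and y: "y \<in> M" "U \<in> linear_extensions (Suc a) (P - {y})"
      and eq: "T(x := Suc a) = U(y := Suc a)"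
    \<comment> \<open>The labels of \<open>U\<close> start at \<open>a + 2\<close>, so in
      \<open>U(y := Suc a)\<close> only \<open>y\<close> carries \<open>Suc a\<close>.\<close>
    have "U z \<noteq> Suc a" if "z \<in> P - {y}" for z
    proof -
      have "bij_betw U (P - {y}) {Suc a<..Suc a + card (P - {y})}"
        using y(2) by (simp add: linear_extensions_def)
      from bij_betwE[OF this] that show ?thesis by force
    qed
    moreover have "(U(y := Suc a)) x = Suc a"
      by (simp flip: eq)
    ultimately have xy: "x = y"
      using x(1) by (auto simp: M_def split: if_splits)
    have "T x = undefined" "U x = undefined"
      using x y xy by (auto simp: linear_extensions_def)
    then have "T = U"
      using eq xy by (metis fun_upd_triv fun_upd_upd)
    with xy show "x = y \<and> T = U" by simp
  qed
  have "card ?S \<le> card (linear_extensions a P)"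
    using card_inj_on_le[OF inj im] assms(1) by (simp add: finite_linear_extensions)
  moreover have "card ?S = (\<Sum>x\<in>M. card (linear_extensions (Suc a) (P - {x})))"
    using assms by (intro card_SigmaI) (auto simp: finite_linear_extensions)
  ultimately show ?thesis by simp
qed

text \<open>Equality is the hook formula for forests, where the elements below any given one form a
  chain. In general the filters of the minimal elements may overlap, which leaves an
  inequality.\<close>

theorem fact_card_le_linear_extensions:
  fixes P :: "'a::order set"
  assumes "finite P"
  shows "fact (card P) \<le> card (linear_extensions a P) * (\<Prod>x\<in>P. card {y \<in> P. x \<le> y})"
  using assms
proof (induction "card P" arbitrary: P a)
  case 0
  then have "P = {}" by simp
  then have "linear_extensions a P = {\<lambda>_. undefined}"
    by (auto simp: linear_extensions_def bij_betw_def)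
  then show ?case using \<open>P = {}\<close> by simp
next
  case (Suc n)
  define M where "M = {x \<in> P. \<forall>y\<in>P. \<not> y < x}"
  define F where "F = (\<lambda>x. card {y \<in> P. x \<le> y})"
  have fM: "finite M" using Suc.prems by (simp add: M_def)
  have "P \<subseteq> (\<Union>x\<in>M. {y \<in> P. x \<le> y})"
  proof
    fix y assume y: "y \<in> P"
    obtain x where x: "x \<in> P" "x \<le> y" "\<And>z. z \<in> P \<Longrightarrow> z \<le> x \<Longrightarrow> x = z"
      using finite_has_minimal2[OF Suc.prems y] by blast
    then have "x \<in> M" by (auto simp: M_def less_le)
    with x y show "y \<in> (\<Union>x\<in>M. {y \<in> P. x \<le> y})" by auto
  qed
  then have "card P \<le> card (\<Union>x\<in>M. {y \<in> P. x \<le> y})"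
    using fM Suc.prems by (intro card_mono) auto
  also have "\<dots> \<le> (\<Sum>x\<in>M. F x)"
    unfolding F_def by (rule card_UN_le[OF fM])
  finally have cover: "card P \<le> (\<Sum>x\<in>M. F x)" .
  \<comment> \<open>The factor \<open>F x\<close> is what the product over \<open>P - {x}\<close>
    lacks.\<close>
  have step: "F x * fact n \<le> card (linear_extensions (Suc a) (P - {x})) * (\<Prod>x\<in>P. F x)"
    if x: "x \<in> M" for x
  proof -
    have xP: "x \<in> P" using x by (simp add: M_def)
    have "n = card (P - {x})" using Suc.hyps(2) xP Suc.prems by simp
    then have "fact n \<le> card (linear_extensions (Suc a) (P - {x})) *
        (\<Prod>z\<in>P - {x}. card {y \<in> P - {x}. z \<le> y})"
      using Suc.hyps(1)[of "P - {x}" "Suc a"] Suc.prems by simp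
    also have "(\<Prod>z\<in>P - {x}. card {y \<in> P - {x}. z \<le> y}) = (\<Prod>z\<in>P - {x}. F z)"
    proof (rule prod.cong)
      \<comment> \<open>By minimality \<open>x\<close> lies in no filter but its own, so deleting it
        leaves the filter of \<open>z\<close> unchanged.\<close>
      fix z assume "z \<in> P - {x}"
      then have "{y \<in> P - {x}. z \<le> y} = {y \<in> P. z \<le> y}"
        using x by (auto simp: M_def less_le)
      then show "card {y \<in> P - {x}. z \<le> y} = F z" by (simp add: F_def)
    qed simp
    finally have "F x * fact n \<le>
        F x * (card (linear_extensions (Suc a) (P - {x})) * (\<Prod>z\<in>P - {x}. F z))"
      by simp
    also have "\<dots> = card (linear_extensions (Suc a) (P - {x})) * (\<Prod>x\<in>P. F x)"
      using prod.remove[OF Suc.prems xP, of F] by simp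
    finally show ?thesis .
  qed
  have "fact (card P) = card P * fact n"
    by (simp flip: Suc.hyps(2))
  also have "\<dots> \<le> (\<Sum>x\<in>M. F x) * fact n"
    using cover by simp
  also have "\<dots> = (\<Sum>x\<in>M. F x * fact n)"
    by (simp add: sum_distrib_right)
  also have "\<dots> \<le> (\<Sum>x\<in>M. card (linear_extensions (Suc a) (P - {x})) * (\<Prod>x\<in>P. F x))"
    by (rule sum_mono) (rule step)
  also have "\<dots> = (\<Sum>x\<in>M. card (linear_extensions (Suc a) (P - {x}))) * (\<Prod>x\<in>P. F x)"
    by (simp add: sum_distrib_right)
  also have "\<dots> \<le> card (linear_extensions a P) * (\<Prod>x\<in>P. F x)"
    unfolding M_def by (intro mult_right_mono sum_card_linear_extensions_le Suc.prems) simp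
  finally show ?case by (simp add: F_def)
qed

section \<open>Labellings increasing along the blocks of a partition into chains\<close>

text \<open>The rank of an element in a finite set of naturals determines it, since the rank is
  strictly increasing on that set.\<close>

lemma card_less_image_unique:
  fixes V :: "nat set"
  assumes "finite V" "s \<in> V" "t \<in> V" "card {v \<in> V. v < s} = card {v \<in> V. v < t}"
  shows "s = t"
proof -
  have "\<not> s < t" if "s \<in> V" "card {v \<in> V. v < s} = card {v \<in> V. v < t}" for s t
  proof
    assume "s < t"
    then have "{v \<in> V. v < s} \<subset> {v \<in> V. v < t}" using that(1) by auto
    then have "card {v \<in> V. v < s} < card {v \<in> V. v < t}"
      using assms(1) by (intro psubset_card_mono) auto
    with that(2) show False by simp
  qed
  from this[of s t] this[of t s] assms show ?thesis by (metis nat_neq_iff)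
qed

text \<open>Here \<open>c\<close> names the block of an element and \<open>q\<close> its position in that block.\<close>

lemma card_block_increasing_le:
  fixes c q :: "'a \<Rightarrow> nat" and A :: "('a \<Rightarrow> nat) set"
  assumes P: "finite P" "\<And>x. x \<in> P \<Longrightarrow> c x < k" "inj_on (\<lambda>x. (c x, q x)) P"
    and A: "\<And>T x. T \<in> A \<Longrightarrow> x \<notin> P \<Longrightarrow> T x = undefined"
      "\<And>T. T \<in> A \<Longrightarrow> bij_betw T P {1..n}"
      "\<And>T x y. T \<in> A \<Longrightarrow> x \<in> P \<Longrightarrow> y \<in> P \<Longrightarrow> c x = c y \<Longrightarrow> q x < q y \<Longrightarrow> T x < T y"
  shows "card A \<le> k ^ n"
proof -
  \<comment> \<open>A labelling becomes a word of length \<open>n\<close> over \<open>k\<close>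
    letters: the letter at \<open>v\<close> is the block containing the label \<open>v\<close>. It
    remains to see that the word determines the labelling.\<close>
  define \<Phi> where "\<Phi> = (\<lambda>T. restrict (\<lambda>v. c (inv_into P T v)) {1..n})"
  have im: "\<Phi> ` A \<subseteq> {1..n} \<rightarrow>\<^sub>E {..<k}"
  proof (rule image_subsetI)
    fix T assume "T \<in> A"
    have "inv_into P T v \<in> P" if "v \<in> {1..n}" for v
      using A(2)[OF \<open>T \<in> A\<close>] that by (metis bij_betw_def inv_into_into)
    then show "\<Phi> T \<in> {1..n} \<rightarrow>\<^sub>E {..<k}"
      unfolding \<Phi>_def using P(2) by auto
  qed
  \<comment> \<open>The set of labels used in each block can be read off from the word.\<close>
  have block: "T ` {y \<in> P. c y = b} = {v \<in> {1..n}. \<Phi> T v = b}" if T: "T \<in> A" for T b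
  proof -
    have "T ` P = {1..n}" "inj_on T P" using A(2)[OF T] by (auto simp: bij_betw_def)
    have \<Phi>: "\<Phi> T (T y) = c y" "T y \<in> {1..n}" if "y \<in> P" for y
    proof -
      show "T y \<in> {1..n}" using \<open>T ` P = {1..n}\<close> that by blast
      then show "\<Phi> T (T y) = c y"
        using \<open>inj_on T P\<close> that by (simp add: \<Phi>_def)
    qed
    show ?thesis
    proof (intro equalityI subsetI)
      fix v assume "v \<in> T ` {y \<in> P. c y = b}"
      then show "v \<in> {v \<in> {1..n}. \<Phi> T v = b}" using \<Phi> by blast
    next
      fix v assume v: "v \<in> {v \<in> {1..n}. \<Phi> T v = b}"
      then obtain y where y: "y \<in> P" "v = T y" using \<open>T ` P = {1..n}\<close> by blast
      then have "c y = b" using v \<Phi>(1)[OF y(1)] by simp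
      with y show "v \<in> T ` {y \<in> P. c y = b}" by simp
    qed
  qed
  \<comment> \<open>The right-hand side does not mention \<open>T\<close>: within its block's label
    set, the label of \<open>x\<close> has a rank fixed by its position.\<close>
  have count: "card {v \<in> T ` {y \<in> P. c y = c x}. v < T x} = card {y \<in> P. c y = c x \<and> q y < q x}"
    if T: "T \<in> A" and x: "x \<in> P" for T x
  proof -
    \<comment> \<open>Positions within one block are distinct, so \<open>q\<close> orders the block
      totally and monotonicity becomes an equivalence.\<close>
    have "T y < T x \<longleftrightarrow> q y < q x" if "y \<in> P" "c y = c x" for y
    proof -
      have "y = x" if "q y = q x"
        by (rule inj_onD[OF P(3) _ \<open>y \<in> P\<close> x]) (simp add: \<open>c y = c x\<close> that)
      moreover have "T y < T x" if "q y < q x"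
        using A(3)[OF T \<open>y \<in> P\<close> x \<open>c y = c x\<close> that] .
      moreover have "T x < T y" if "q x < q y"
        using A(3)[OF T x \<open>y \<in> P\<close> \<open>c y = c x\<close>[symmetric] that] .
      ultimately show ?thesis
        by (metis less_asym' less_irrefl linorder_neqE_nat)
    qed
    then have "{v \<in> T ` {y \<in> P. c y = c x}. v < T x} = T ` {y \<in> P. c y = c x \<and> q y < q x}"
      by auto
    moreover have "inj_on T {y \<in> P. c y = c x \<and> q y < q x}"
      using A(2)[OF T] by (auto simp: bij_betw_def inj_on_def)
    ultimately show ?thesis by (simp add: card_image)
  qed
  have inj: "inj_on \<Phi> A"
  proof (rule inj_onI, rule ext)
    fix T U x assume T: "T \<in> A" and U: "U \<in> A" and eq: "\<Phi> T = \<Phi> U"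
    show "T x = U x"
    proof (cases "x \<in> P")
      case True
      let ?B = "{y \<in> P. c y = c x}"
      have V: "U ` ?B = T ` ?B" using block[OF T] block[OF U] eq by simp
      have "T x \<in> T ` ?B" "U x \<in> U ` ?B" using True by auto
      then show ?thesis
        using card_less_image_unique[of "T ` ?B" "T x" "U x"] P(1)
          count[OF T True] count[OF U True] V by simp
    next
      case False
      then show ?thesis using A(1)[OF T] A(1)[OF U] by simp
    qed
  qed
  have "card A \<le> card ({1..n} \<rightarrow>\<^sub>E {..<k})"
    by (rule card_inj_on_le[OF inj im]) (simp add: finite_PiE)
  then show ?thesis by (simp add: card_PiE)
qed

section \<open>Bounds for the number of standard tableaux\<close>

text \<open>Since \<open>l\<close> is decreasing, the rows meeting column \<open>j\<close> form an
  initial segment, and its cardinality is the first row missing from it.\<close>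

lemma less_conj_part_iff:
  assumes "is_partition l"
  shows "i < conj_part l j \<longleftrightarrow> j < l i"
proof -
  let ?S = "{i. j < l i}"
  have anti: "l b \<le> l a" if "a \<le> b" for a b
    using assms that by (auto simp: is_partition_def antimono_def)
  have fin: "finite ?S"
    using assms by (auto simp: is_partition_def elim: rev_finite_subset)
  show ?thesis
  proof
    assume "j < l i"
    then have "{..i} \<subseteq> ?S" using anti by (auto intro: less_le_trans)
    from card_mono[OF fin this] show "i < conj_part l j" by (simp add: conj_part_def)
  next
    assume *: "i < conj_part l j"
    show "j < l i"
    proof (rule ccontr)
      assume n: "\<not> j < l i"
      have "?S \<subseteq> {..<i}"
      proof
        fix a assume "a \<in> ?S"
        then show "a \<in> {..<i}" using n anti[of i a] by (cases "a < i") auto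
      qed
      from card_mono[OF _ this] * show False by (simp add: conj_part_def)
    qed
  qed
qed

lemma num_syt_le_width_power:
  assumes s: "is_skew_shape l m" and fin: "finite (cells l m)"
  shows "num_syt l m \<le> skew_width l m ^ skew_size l m"
proof -
  have p: "is_partition l" using s by (simp add: is_skew_shape_def)
  have rows: "num_syt l m \<le> conj_part l 0 ^ skew_size l m"
    unfolding num_syt_def
    by (rule card_block_increasing_le[where P = "cells l m" and c = fst and q = snd])
      (use fin in \<open>auto simp: standard_tableaux_def less_conj_part_iff[OF p] cells_def inj_on_def\<close>)
  have "l i \<le> l 0" for i using p by (auto simp: is_partition_def antimono_def)
  then have cols: "num_syt l m \<le> l 0 ^ skew_size l m"
    unfolding num_syt_def
    by (intro card_block_increasing_le[where P = "cells l m" and c = snd and q = fst])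
      (use fin in \<open>auto simp: standard_tableaux_def cells_def inj_on_def intro: less_le_trans\<close>)
  show ?thesis using rows cols by (simp add: skew_width_def min_def)
qed

text \<open>The order on pairs is componentwise. The sides of the enclosing rectangle are leg plus
  one and arm plus one, while the hook length is arm plus leg plus one.\<close>

lemma card_filter_le_hook_length_square:
  assumes s: "is_skew_shape l m" and u: "u \<in> cells l m"
  shows "card {v \<in> cells l m. u \<le> v} \<le> hook_length l u ^ 2"
proof -
  obtain i j where ij: "u = (i, j)" by force
  have p: "is_partition l" using s by (simp add: is_skew_shape_def)
  have anti: "l b \<le> l a" if "a \<le> b" for a b
    using p that by (auto simp: is_partition_def antimono_def)
  have "{v \<in> cells l m. u \<le> v} \<subseteq> {i..<conj_part l j} \<times> {j..<l i}"
  proof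
    fix v assume v: "v \<in> {v \<in> cells l m. u \<le> v}"
    obtain a b where ab: "v = (a, b)" by force
    from v have "i \<le> a" "j \<le> b" "b < l a" by (auto simp: ab ij cells_def)
    then show "v \<in> {i..<conj_part l j} \<times> {j..<l i}"
      using anti[of i a] by (simp add: ab less_conj_part_iff[OF p])
  qed
  then have "card {v \<in> cells l m. u \<le> v} \<le> card ({i..<conj_part l j} \<times> {j..<l i})"
    by (intro card_mono) auto
  also have "\<dots> = (conj_part l j - i) * (l i - j)" by simp
  also have "\<dots> \<le> hook_length l u * hook_length l u"
    by (rule mult_mono) (auto simp: hook_length_def ij)
  finally show ?thesis by (simp add: power2_eq_square)
qed

lemma fact_le_num_syt_depth_power:
  assumes s: "is_skew_shape l m" and fin: "finite (cells l m)"
  shows "fact (skew_size l m) \<le> num_syt l m * (skew_depth l m ^ 2) ^ skew_size l m"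
proof -
  let ?P = "cells l m"
  \<comment> \<open>Offset 0 gives exactly the labels of a tableau.\<close>
  have eq: "{0<..0 + card ?P} = {1..skew_size l m}" by (auto simp: skew_size_def)
  \<comment> \<open>A step to the right or down is a strict increase in the componentwise order, so
    linear extensions increase along rows and columns.\<close>
  have sub: "linear_extensions 0 ?P \<subseteq> standard_tableaux l m"
    unfolding linear_extensions_def standard_tableaux_def eq by (auto simp: less_le)
  have "finite (standard_tableaux l m)"
    by (rule finite_bij_extensional[OF fin, of "{1..skew_size l m}"])
      (auto simp: standard_tableaux_def)
  then have le: "card (linear_extensions 0 ?P) \<le> num_syt l m"
    unfolding num_syt_def using sub by (rule card_mono)
  have "(\<Prod>u\<in>?P. card {v \<in> ?P. u \<le> v}) \<le> (\<Prod>u\<in>?P. skew_depth l m ^ 2)"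
  proof (rule prod_mono)
    fix u assume u: "u \<in> ?P"
    have "hook_length l u \<le> skew_depth l m"
      unfolding skew_depth_def using fin u by (intro Max_ge) auto
    then show "0 \<le> card {v \<in> ?P. u \<le> v} \<and> card {v \<in> ?P. u \<le> v} \<le> skew_depth l m ^ 2"
      using card_filter_le_hook_length_square[OF s u] power_mono[of "hook_length l u" _ 2]
      by (meson le0 le_trans)
  qed
  then have "card (linear_extensions 0 ?P) * (\<Prod>u\<in>?P. card {v \<in> ?P. u \<le> v})
      \<le> num_syt l m * (skew_depth l m ^ 2) ^ card ?P"
    using le by (intro mult_mono) auto
  then show ?thesis
    using fact_card_le_linear_extensions[OF fin, of 0] by (simp add: skew_size_def)
qed

section \<open>Asymptotics\<close>

text \<open>The number \<open>n ^ n / fact n\<close> is a single term of the exponential series at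
  \<open>n\<close>, hence at most \<open>exp n\<close>.\<close>

lemma ln_fact_ge: "ln (fact n) \<ge> real n * ln (real n) - real n"
proof (cases "n = 0")
  case False
  have "(\<lambda>k. real n ^ k / fact k) sums exp (real n)"
    using exp_converges[of "real n"] by (simp add: field_simps)
  then have "real n ^ n / fact n \<le> exp (real n)"
    using sum_le_suminf[of "\<lambda>k. real n ^ k / fact k" "{n}"] by (simp add: sums_iff)
  then have "ln (real n ^ n / fact n) \<le> real n"
    using False ln_mono[of "real n ^ n / fact n" "exp (real n)"] by simp
  then show ?thesis
    using False by (simp add: ln_div ln_realpow)
qed simp

theorem theorem7p1:
  fixes g :: "nat \<Rightarrow> nat" and lam mu :: "nat \<Rightarrow> nat \<Rightarrow> nat"
  assumes "subpolynomial_growth g"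
    and "\<And>n. n \<ge> 1 \<Longrightarrow> is_skew_shape (lam n) (mu n)"
    and "\<And>n. n \<ge> 1 \<Longrightarrow> is_connected_skew (lam n) (mu n)"
    and "\<And>n. n \<ge> 1 \<Longrightarrow> skew_size (lam n) (mu n) = n"
    and "subpolynomial_depth_shape lam mu g"
  shows "\<exists>R :: nat \<Rightarrow> real.
           R \<in> \<Theta>(\<lambda>n. real n * ln (real (g n))) \<and>
           (\<forall>\<^sub>F n in at_top. R n \<ge> 0) \<and>
           (\<forall>n\<ge>1. ln (real (num_syt (lam n) (mu n))) = real n * ln (real n) - R n)"
proof -
  define e where "e = (\<lambda>n. real (num_syt (lam n) (mu n)))"
  define W where "W = (\<lambda>n. real (skew_width (lam n) (mu n)))"
  define D where "D = (\<lambda>n. real (skew_depth (lam n) (mu n)))"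
  \<comment> \<open>With \<open>R\<close> the exact difference, the required identity holds by
    definition and only its growth has to be shown.\<close>
  define R where "R = (\<lambda>n. real n * ln (real n) - ln (e n))"
  \<comment> \<open>An infinite set has \<open>card\<close> equal to 0, so size
    \<open>n \<ge> 1\<close> forces finiteness.\<close>
  have fin: "finite (cells (lam n) (mu n))" if "n \<ge> 1" for n
    using assms(4)[OF that] that by (auto simp: skew_size_def intro: card_ge_0_finite)
  have upper: "e n \<le> W n ^ n" if n: "n \<ge> 1" for n
    using num_syt_le_width_power[OF assms(2)[OF n] fin[OF n]] assms(4)[OF n]
    unfolding e_def W_def by (metis of_nat_le_iff of_nat_power)
  have lower: "fact n \<le> e n * (D n ^ 2) ^ n" if n: "n \<ge> 1" for n
    using fact_le_num_syt_depth_power[OF assms(2)[OF n] fin[OF n]] assms(4)[OF n]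
    unfolding e_def D_def by (metis of_nat_le_iff of_nat_power of_nat_mult of_nat_fact)
  have "W \<in> O(\<lambda>n. real n / real (g n))" "D \<in> O(\<lambda>n. real (g n))"
    using assms(5) by (auto simp: subpolynomial_depth_shape_def W_def D_def bigtheta_def)
  then obtain A B where A: "A > 0" "\<forall>\<^sub>F n in at_top. W n \<le> A * (real n / real (g n))"
    and B: "B > 0" "\<forall>\<^sub>F n in at_top. D n \<le> B * real (g n)"
    by (auto simp: W_def D_def elim!: landau_o.bigE)
  have g1: "real (g n) \<ge> 1" if "n \<ge> 1" for n
    using assms(1) that by (auto simp: subpolynomial_growth_def)
  have g_lim: "filterlim (\<lambda>n. ln (real (g n))) at_top at_top"
    using assms(1) unfolding subpolynomial_growth_def
    by (intro filterlim_compose[OF ln_at_top] filterlim_compose[OF filterlim_real_sequentially]) simp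
  \<comment> \<open>The threshold \<open>2 * ln A\<close> makes \<open>ln A\<close> at most half of
    \<open>ln (g n)\<close>, whence the constant \<open>1 / 2\<close> below. The threshold 1 lets
    terms linear in \<open>n\<close> be absorbed into \<open>n * ln (g n)\<close>.\<close>
  have ev: "\<forall>\<^sub>F n in at_top. n \<ge> 1 \<and> ln (real (g n)) \<ge> max 1 (2 * ln A) \<and>
      W n \<le> A * (real n / real (g n)) \<and> D n \<le> B * real (g n)"
    using A(2) B(2) g_lim eventually_ge_at_top[of 1]
    by (auto simp: filterlim_at_top intro!: eventually_conj)
  \<comment> \<open>In \<open>3 + 2 * \<bar>ln B\<bar>\<close>, 1 comes from the error in
    \<open>ln_fact_ge\<close>, 2 from the squared depth, and the rest from the constant
    \<open>B\<close>.\<close>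
  have bounds: "\<forall>\<^sub>F n in at_top. n \<ge> 1 \<and> 0 \<le> real n * ln (real (g n)) \<and>
      1 / 2 * (real n * ln (real (g n))) \<le> R n \<and>
      R n \<le> (3 + 2 * \<bar>ln B\<bar>) * (real n * ln (real (g n)))"
    using ev
  proof eventually_elim
    case (elim n)
    then have n: "n \<ge> 1" and L: "ln (real (g n)) \<ge> 1" "ln (real (g n)) \<ge> 2 * ln A"
      and Wn: "W n \<le> A * (real n / real (g n))" and Dn: "D n \<le> B * real (g n)" by auto
    note g = g1[OF n]
    \<comment> \<open>Positivity of the factorial forces both factors to be positive, so their
      logarithms behave; \<open>n \<ge> 1\<close> keeps the exponent nonzero.\<close>
    have "e n * (D n ^ 2) ^ n > 0"
      using lower[OF n] fact_gt_zero[of n] by (rule less_le_trans[rotated])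
    then have pos: "e n > 0" "D n > 0"
      using n by (auto simp: e_def D_def zero_less_mult_iff zero_less_power_eq intro!: Nat.gr0I)
    have Wpos: "W n > 0"
      using upper[OF n] pos(1) n by (cases "W n = 0") (auto simp: W_def zero_power)
    \<comment> \<open>An upper bound for \<open>e\<close> is a lower bound for \<open>R\<close>; the
      factor \<open>1 / g n\<close> in the width supplies the \<open>ln (g n)\<close> term.\<close>
    have "ln (e n) \<le> ln (W n ^ n)"
      using upper[OF n] pos(1) Wpos by simp
    also have "\<dots> = real n * ln (W n)"
      using Wpos by (simp add: ln_realpow)
    also have "\<dots> \<le> real n * ln (A * (real n / real (g n)))"
      using Wn Wpos by (intro mult_left_mono ln_mono) auto
    also have "\<dots> = real n * (ln A + ln (real n) - ln (real (g n)))"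
      using A(1) n g by (simp add: ln_mult ln_div)
    also have "\<dots> \<le> real n * (ln (real n) - 1 / 2 * ln (real (g n)))"
      using L by (intro mult_left_mono) auto
    finally have low: "1 / 2 * (real n * ln (real (g n))) \<le> R n"
      by (simp add: R_def algebra_simps)
    \<comment> \<open>Conversely, the lower bound for \<open>e\<close> bounds \<open>R\<close> from
      above.\<close>
    have "real n * ln (real n) - real n \<le> ln (fact n)"
      by (rule ln_fact_ge)
    also have "\<dots> \<le> ln (e n * (D n ^ 2) ^ n)"
      using lower[OF n] by (intro ln_mono) auto
    also have "\<dots> = ln (e n) + real n * (2 * ln (D n))"
      using pos by (simp add: ln_mult ln_realpow)
    also have "\<dots> \<le> ln (e n) + real n * (2 * ln (B * real (g n)))"
      using Dn pos(2) by (intro add_left_mono mult_left_mono ln_mono) auto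
    also have "\<dots> = ln (e n) + real n * (2 * ln B + 2 * ln (real (g n)))"
      using B(1) g by (simp add: ln_mult)
    finally have "R n \<le> real n * (1 + 2 * ln B + 2 * ln (real (g n)))"
      by (simp add: R_def algebra_simps)
    also have "\<dots> \<le> real n * ((3 + 2 * \<bar>ln B\<bar>) * ln (real (g n)))"
    proof (intro mult_left_mono)
      have "\<bar>ln B\<bar> * 1 \<le> \<bar>ln B\<bar> * ln (real (g n))"
        using L by (intro mult_left_mono) auto
      then show "1 + 2 * ln B + 2 * ln (real (g n)) \<le> (3 + 2 * \<bar>ln B\<bar>) * ln (real (g n))"
        using L abs_ge_self[of "ln B"] by (simp add: algebra_simps)
    qed simp
    finally show ?case
      using low n L by (simp add: algebra_simps)
  qed
  have "R \<in> O(\<lambda>n. real n * ln (real (g n)))"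
    by (rule landau_o.bigI[of "3 + 2 * \<bar>ln B\<bar>"]) (use bounds in \<open>auto elim!: eventually_mono\<close>)
  moreover have "R \<in> \<Omega>(\<lambda>n. real n * ln (real (g n)))"
    by (rule landau_omega.bigI[of "1 / 2"]) (use bounds in \<open>auto elim!: eventually_mono\<close>)
  moreover have "\<forall>\<^sub>F n in at_top. R n \<ge> 0"
    using bounds by (auto elim!: eventually_mono)
  ultimately show ?thesis
    by (intro exI[of _ R]) (auto simp: R_def e_def bigtheta_def)
qed

end
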